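(* Let $k=2$ on the reference equilateral triangle, with the Dubiner basis $\phi_1,\dots,\phi_6$. The $6\times6$ modal matrix $\tilde{\mathbf Q}$ satisfying the extended-range conditions (E1)–(E3) of the context is, with free parameters $q_0,q_1\in\mathbb R$, $$\tilde{\mathbf Q}=\begin{bmatrix}0&0&0&0&0&0\\0&0&0&0&0&0\\0&0&(5q_0-q_1)/4&0&0&(q_0-q_1)\sqrt{5/4}\\0&0&0&0&0&0\\0&0&0&0&q_1&0\\0&0&(q_0-q_1)\sqrt{5/4}&0&0&q_0\end{bmatrix}.$$ The requirement that $\tilde{\mathbf M}+\tilde{\mathbf Q}$ be positive definite leads to the following conditions on stability: $$q_1>-1\quad\text{and}\quad 9q_0-5q_1>-4 .$$ The single-parameter FR scheme of Castonguay et al., given by the matrix $\tilde{\mathbf Q}_{\mathrm C}$ of the context, is recovered for $$q_0=\frac{410c}{3},\qquad q_1=150c,$$ which leads to the stability condition $c>-\tfrac1{150}$.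
   Context: Reference triangle $\hat K$: vertices $(-1,-1/\sqrt3)$, $(1,-1/\sqrt3)$, $(0,2/\sqrt3)$. Dubiner basis of polynomials of total degree $\le k$: $$\phi_i(x,y)=\frac{2}{3^{1/4}}(1-b)^v\psi_v^{(0,0)}(a)\,\psi_w^{(2v+1,0)}(b),\quad a=\frac{3x}{2-\sqrt3y},\quad b=\frac{2\sqrt3y-1}{3},$$ where $v,w\ge0$ are integers with $v+w\le k$ and $0=v^2-(2k+3)v-2(w-i+1)$, i.e. $i=w+1+v(2k+3-v)/2$ (indices start at 1). Here $\psi_n^{(\alpha,\beta)}$ is the normalised Jacobi polynomial (unit norm in $L^2([-1,1],(1-s)^\alpha(1+s)^\beta\mathrm ds)$). The modal mass matrix $\tilde{\mathbf M}$, with entries $\int_{\hat K}\phi_i\phi_j\,\mathrm d\mathbf x$, is the identity. $\tilde{\mathbf D}_x,\tilde{\mathbf D}_y$ are the matrices of $\partial_x,\partial_y$ in this basis. Extended-range conditions on $\tilde{\mathbf Q}$: (E1) $\tilde{\mathbf Q}=\tilde{\mathbf Q}^T$; (E2) $\tilde{\mathbf Q}\tilde{\mathbf D}_x+\tilde{\mathbf D}_x^T\tilde{\mathbf Q}^T=0$ and $\tilde{\mathbf Q}\tilde{\mathbf D}_y+\tilde{\mathbf D}_y^T\tilde{\mathbf Q}^T=0$; (E3) symmetry: $\tilde{\mathbf Q}$ commutes with the matrix (in the basis $\phi_i$) of $f\mapsto f\circ R$ for the rotation $R$ by $2\pi/3$ about the centroid (the origin), and with the matrix of $f(x,y)\mapsto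 f(-x,y)$. Together with positive definiteness of $\tilde{\mathbf M}+\tilde{\mathbf Q}$, these define the extended range of linearly stable flux reconstruction (FR) schemes, with correction matrix $\tilde{\mathbf C}=(\tilde{\mathbf M}+\tilde{\mathbf Q})^{-1}\tilde{\mathbf L}_\partial^T\mathbf W_\partial$, where $\tilde{\mathbf L}_\partial$ evaluates the modes at the boundary flux points and $\mathbf W_\partial$ is the diagonal matrix of non-negative surface quadrature weights. Single-parameter scheme (Castonguay et al.): FR with this total order basis is stable in the broken Sobolev norm $$\frac12\int_{\hat K}u^2+\frac cA\sum_{m=1}^{k+1}\binom{k}{m-1}\big(D^{m,k}u\big)^2\,\mathrm d\mathbf x,\qquad D^{m,k}=\frac{\partial^k}{\partial x^{k-m+1}\partial y^{m-1}},\qquad A=|\hat K|,$$ and correspondingly $$\tilde{\mathbf Q}_{\mathrm C}=\frac cA\sum_{m=1}^{k+1}\binom{k}{m-1}(\tilde{\mathbf K}^{m,k})^T\tilde{\mathbf M}\tilde{\mathbf K}^{m,k},\qquad \tilde{\mathbf K}^{m,k}=\tilde{\mathbf D}_x^{\,k-m+1}\tilde{\mathbf D}_y^{\,m-1}.$$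
   Formalization: With the context's prefactor c/A (A = √3) the printed values fail: q1 would be 150c/√3. The formal statement proves q0 = 410c/3, q1 = 150c and c > −1/150 for Q_C with c replaced by A·c, i.e. with prefactor c instead of c/A. *)

theory Defs
  imports "HOL-Analysis.Analysis" "Jordan_Normal_Form.Matrix"
begin

definition ref_triangle :: "(real \<times> real) set" where
  "ref_triangle = convex hull {(-1, -1 / sqrt 3), (1, -1 / sqrt 3), (0, 2 / sqrt 3)}"

definition ref_area :: real where
  "ref_area = measure lborel ref_triangle"

(* Jacobi polynomial P_n^(alpha,beta) in the classical normalisation P_n(1) = (n + alpha choose n);
   only natural parameters occur in the Dubiner basis. *)
definition jacobi :: "nat \<Rightarrow> nat \<Rightarrow> nat \<Rightarrow> real \<Rightarrow> real" where
  "jacobi \<alpha> \<beta> n s = (\<Sum>l\<le>n. real ((n + \<alpha>) choose (n - l)) * real ((n + \<beta>) choose l)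
      * ((s - 1) / 2) ^ l * ((s + 1) / 2) ^ (n - l))"

definition jacobi_normalised :: "nat \<Rightarrow> nat \<Rightarrow> nat \<Rightarrow> real \<Rightarrow> real" where
  "jacobi_normalised \<alpha> \<beta> n s = jacobi \<alpha> \<beta> n s
     / sqrt (integral {-1..1} (\<lambda>t. (jacobi \<alpha> \<beta> n t)\<^sup>2 * (1 - t) ^ \<alpha> * (1 + t) ^ \<beta>))"

definition num_modes :: "nat \<Rightarrow> nat" where
  "num_modes k = (k + 1) * (k + 2) div 2"

(* the unique (v, w) belonging to the mode number i in {1..num_modes k} *)
definition mode_degrees :: "nat \<Rightarrow> nat \<Rightarrow> nat \<times> nat" where
  "mode_degrees k i = (THE (v, w). v + w \<le> k \<and>
     0 = (int v)\<^sup>2 - (2 * int k + 3) * int v - 2 * (int w - int i + 1))"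

(* Division by zero makes this differ from the polynomial on the line y = 2 / sqrt 3, which meets
   the triangle only in its top vertex. *)
definition dubiner :: "nat \<Rightarrow> nat \<Rightarrow> real \<times> real \<Rightarrow> real" where
  "dubiner k i = (\<lambda>(x, y).
     let (v, w) = mode_degrees k i;
         a = 3 * x / (2 - sqrt 3 * y);
         b = (2 * sqrt 3 * y - 1) / 3
     in 2 / 3 powr (1/4) * (1 - b) ^ v * jacobi_normalised 0 0 v a
          * jacobi_normalised (2 * v + 1) 0 w b)"

(* Modes are numbered from 1, matrix positions from 0. *)
definition modal_mass :: "nat \<Rightarrow> real mat" where
  "modal_mass k = mat (num_modes k) (num_modes k)
     (\<lambda>(i, j). integral ref_triangle (\<lambda>p. dubiner k (i + 1) p * dubiner k (j + 1) p))"

(* Matrix of the linear operator T in the Dubiner basis. A polynomial is determined by its values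
   on the interior of the triangle, where the collapsed coordinates are regular. *)
definition modal_matrix :: "nat \<Rightarrow> ((real \<times> real \<Rightarrow> real) \<Rightarrow> (real \<times> real \<Rightarrow> real)) \<Rightarrow> real mat" where
  "modal_matrix k T = (THE B. B \<in> carrier_mat (num_modes k) (num_modes k) \<and>
     (\<forall>j < num_modes k. \<forall>p \<in> interior ref_triangle.
        T (dubiner k (j + 1)) p = (\<Sum>i < num_modes k. B $$ (i, j) * dubiner k (i + 1) p)))"

definition partial_x :: "(real \<times> real \<Rightarrow> real) \<Rightarrow> (real \<times> real \<Rightarrow> real)" where
  "partial_x f = (\<lambda>(x, y). deriv (\<lambda>t. f (t, y)) x)"

definition partial_y :: "(real \<times> real \<Rightarrow> real) \<Rightarrow> (real \<times> real \<Rightarrow> real)" where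
  "partial_y f = (\<lambda>(x, y). deriv (\<lambda>t. f (x, t)) y)"

definition rotation :: "real \<times> real \<Rightarrow> real \<times> real" where
  "rotation = (\<lambda>(x, y). (cos (2 * pi / 3) * x - sin (2 * pi / 3) * y,
                         sin (2 * pi / 3) * x + cos (2 * pi / 3) * y))"

definition reflection :: "real \<times> real \<Rightarrow> real \<times> real" where
  "reflection = (\<lambda>(x, y). (- x, y))"

definition modal_Dx :: "nat \<Rightarrow> real mat" where
  "modal_Dx k = modal_matrix k partial_x"

definition modal_Dy :: "nat \<Rightarrow> real mat" where
  "modal_Dy k = modal_matrix k partial_y"

definition modal_rotation :: "nat \<Rightarrow> real mat" where
  "modal_rotation k = modal_matrix k (\<lambda>f. f \<circ> rotation)"

definition modal_reflection :: "nat \<Rightarrow> real mat" where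
  "modal_reflection k = modal_matrix k (\<lambda>f. f \<circ> reflection)"

definition extended_range_conditions :: "nat \<Rightarrow> real mat \<Rightarrow> bool" where
  "extended_range_conditions k Q \<longleftrightarrow>
     Q \<in> carrier_mat (num_modes k) (num_modes k) \<and>
     Q = transpose_mat Q \<and>
     Q * modal_Dx k + transpose_mat (modal_Dx k) * transpose_mat Q
       = 0\<^sub>m (num_modes k) (num_modes k) \<and>
     Q * modal_Dy k + transpose_mat (modal_Dy k) * transpose_mat Q
       = 0\<^sub>m (num_modes k) (num_modes k) \<and>
     Q * modal_rotation k = modal_rotation k * Q \<and>
     Q * modal_reflection k = modal_reflection k * Q"

definition positive_definite :: "real mat \<Rightarrow> bool" where
  "positive_definite B \<longleftrightarrow> square_mat B \<and> transpose_mat B = B \<and>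
     (\<forall>z \<in> carrier_vec (dim_row B). z \<noteq> 0\<^sub>v (dim_row B) \<longrightarrow> scalar_prod z (B *\<^sub>v z) > 0)"

definition modal_K :: "nat \<Rightarrow> nat \<Rightarrow> real mat" where
  "modal_K m k = (modal_Dx k ^\<^sub>m (k + 1 - m)) * (modal_Dy k ^\<^sub>m (m - 1))"

(* For k = 2 the coefficient c / ref_area (not c) has to be compared with the values
   q0 = 410 c / 3, q1 = 150 c of the literature: these are the parameters of
   Q_castonguay 2 (ref_area * c), where ref_area = sqrt 3. *)
definition Q_castonguay :: "nat \<Rightarrow> real \<Rightarrow> real mat" where
  "Q_castonguay k c = mat (num_modes k) (num_modes k)
     (\<lambda>(i, j). c / ref_area * (\<Sum>m = 1..k + 1. real (k choose (m - 1))
        * (transpose_mat (modal_K m k) * modal_mass k * modal_K m k) $$ (i, j)))"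

definition Q_extended :: "real \<Rightarrow> real \<Rightarrow> real mat" where
  "Q_extended q\<^sub>0 q\<^sub>1 = mat_of_rows_list 6
    [[0, 0, 0, 0, 0, 0],
     [0, 0, 0, 0, 0, 0],
     [0, 0, (5 * q\<^sub>0 - q\<^sub>1) / 4, 0, 0, (q\<^sub>0 - q\<^sub>1) * sqrt (5 / 4)],
     [0, 0, 0, 0, 0, 0],
     [0, 0, 0, 0, q\<^sub>1, 0],
     [0, 0, (q\<^sub>0 - q\<^sub>1) * sqrt (5 / 4), 0, 0, q\<^sub>0]]"

end

theory Submission
  imports Defs
begin

text \<open>In the coordinates \<open>(x, r)\<close>, where \<open>r = (2 - sqrt 3 * y) / 3\<close> is half the width of the triangle
at height \<open>y\<close>, the collapsed coordinates are \<open>a = x / r\<close> and \<open>b = 1 - 2 * r\<close>, the triangle is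
\<open>\<bar>x\<bar> \<le> r \<le> 1\<close>, and the rotation has rational coefficients. The six modes become explicit quadratic
polynomials in \<open>x\<close> and \<open>r\<close>; their products are integrated by the closed form of the monomial
integrals, and the modal matrices are read off. The conditions (E1) and (E2) make \<open>Q\<close> vanish outside
the block of the modes 3, 5, 6, reflection removes the couplings with the odd mode 5, and rotation
leaves two parameters. Orthogonal eigenvectors for the modes 3 and 6 are \<open>(2, - sqrt 5)\<close>
and \<open>(sqrt 5, 2)\<close>: the second one is the rotation-invariant polynomial, the first one
spans a two-dimensional representation together with mode 5, which is why both have the eigenvalue \<open>q\<^sub>1\<close>.\<close>

section \<open>The reference triangle\<close>

definition half_width :: "real \<Rightarrow> real" where
  "half_width y = (2 - sqrt 3 * y) / 3"

lemma half_width_alt: "y = (2 - 3 * half_width y) / sqrt 3"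
proof -
  have "2 - 3 * half_width y = sqrt 3 * y" by (simp add: half_width_def diff_divide_distrib)
  then show ?thesis by simp
qed

text \<open>With \<open>r = half_width y\<close>, the barycentric coordinates of
  \<open>(x, y)\<close> are \<open>(r - x) / 2\<close>, \<open>(r + x) / 2\<close> and
  \<open>1 - r\<close>; the inequalities say that they are nonnegative.\<close>

lemma ref_triangle_eq:
  "ref_triangle = {(x, y). \<bar>x\<bar> \<le> half_width y \<and> half_width y \<le> 1}" (is "_ = ?S")
proof (rule Set.set_eqI, rule iffI)
  fix p :: "real \<times> real"
  assume "p \<in> ref_triangle"
  then obtain u v w where uvw: "0 \<le> u" "0 \<le> v" "0 \<le> w" "u + v + w = 1"
    and p: "p = u *\<^sub>R (-1, -1 / sqrt 3) + v *\<^sub>R (1, -1 / sqrt 3) + w *\<^sub>R (0, 2 / sqrt 3)"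
    unfolding ref_triangle_def convex_hull_3 by auto
  have "snd p = (2 * w - u - v) / sqrt 3"
    by (simp add: p add_divide_distrib diff_divide_distrib)
  then have "half_width (snd p) = (2 - (2 * w - u - v)) / 3"
    by (simp add: half_width_def)
  also have "\<dots> = u + v" using uvw(4) by (simp add: field_simps)
  finally have "half_width (snd p) = u + v" .
  moreover have "fst p = v - u" by (simp add: p)
  ultimately show "p \<in> {(x, y). \<bar>x\<bar> \<le> half_width y \<and> half_width y \<le> 1}"
    using uvw by (auto simp: case_prod_unfold)
next
  fix p :: "real \<times> real"
  assume "p \<in> {(x, y). \<bar>x\<bar> \<le> half_width y \<and> half_width y \<le> 1}"
  then obtain x y where p: "p = (x, y)" and r: "\<bar>x\<bar> \<le> half_width y" "half_width y \<le> 1" by auto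
  let ?r = "half_width y"
  have "p = ((?r - x) / 2) *\<^sub>R (-1, -1 / sqrt 3) + ((?r + x) / 2) *\<^sub>R (1, -1 / sqrt 3)
      + (1 - ?r) *\<^sub>R (0, 2 / sqrt 3)"
    unfolding p by (subst (1) half_width_alt[of y]) (simp add: field_simps)
  moreover have "0 \<le> (?r - x) / 2" "0 \<le> (?r + x) / 2" "0 \<le> 1 - ?r"
    "(?r - x) / 2 + (?r + x) / 2 + (1 - ?r) = 1"
    using r by (auto simp: field_simps)
  ultimately show "p \<in> ref_triangle"
    unfolding ref_triangle_def convex_hull_3 by blast
qed

text \<open>An open subset of an intersection of closed half-planes lies in the interior of each of
  them, and the interior of a closed half-plane with nonzero normal is the open one.\<close>

lemma interior_ref_triangle:
  "interior ref_triangle = {(x, y). \<bar>x\<bar> < half_width y \<and> half_width y < 1}"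
proof (rule interior_unique)
  show "{(x, y). \<bar>x\<bar> < half_width y \<and> half_width y < 1} \<subseteq> ref_triangle"
    unfolding ref_triangle_eq by auto
  show "open {(x, y). \<bar>x\<bar> < half_width y \<and> half_width y < 1}"
    unfolding half_width_def case_prod_unfold
    by (intro open_Collect_conj open_Collect_less continuous_intros) simp_all
next
  fix T assume T: "T \<subseteq> ref_triangle" "open T"
  \<comment> \<open>Outward normals of the three edges, scaled so that the edge equations have
    right-hand sides 2, 2 and 1.\<close>
  define a b c :: "real \<times> real" where abc: "a = (3, sqrt 3)" "b = (-3, sqrt 3)" "c = (0, - sqrt 3)"
  have nz: "a \<noteq> 0" "b \<noteq> 0" "c \<noteq> 0" by (auto simp: abc zero_prod_def)
  have half: "(\<bar>x\<bar> \<le> half_width y \<and> half_width y \<le> 1) \<longleftrightarrow>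
      a \<bullet> (x, y) \<le> 2 \<and> b \<bullet> (x, y) \<le> 2 \<and> c \<bullet> (x, y) \<le> 1"
    "(\<bar>x\<bar> < half_width y \<and> half_width y < 1) \<longleftrightarrow>
      a \<bullet> (x, y) < 2 \<and> b \<bullet> (x, y) < 2 \<and> c \<bullet> (x, y) < 1" for x y
    by (auto simp: abc half_width_def field_simps abs_le_iff abs_less_iff)
  have "T \<subseteq> {p. a \<bullet> p \<le> 2}" "T \<subseteq> {p. b \<bullet> p \<le> 2}" "T \<subseteq> {p. c \<bullet> p \<le> 1}"
    using T(1) half(1) unfolding ref_triangle_eq by auto
  then have "T \<subseteq> interior {p. a \<bullet> p \<le> 2}" "T \<subseteq> interior {p. b \<bullet> p \<le> 2}"
    "T \<subseteq> interior {p. c \<bullet> p \<le> 1}"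
    using T(2) by (auto simp only: interior_maximal)
  then show "T \<subseteq> {(x, y). \<bar>x\<bar> < half_width y \<and> half_width y < 1}"
    using nz half by (auto simp: subset_iff)
qed

lemma has_real_derivative_half_width:
  "(half_width has_real_derivative - 1 / sqrt 3) (at y within A)"
  unfolding half_width_def
  by (rule derivative_eq_intros refl | simp)+ (simp add: field_simps)

section \<open>Integration over the triangle\<close>

lemma compact_ref_triangle: "compact ref_triangle"
  unfolding ref_triangle_def by (intro finite_imp_compact_convex_hull) auto

lemma mem_ref_triangle:
  "(x, y) \<in> ref_triangle \<longleftrightarrow> y \<in> {-1 / sqrt 3..2 / sqrt 3} \<and> x \<in> {- half_width y..half_width y}"
proof -
  have "half_width y \<le> 1 \<longleftrightarrow> -1 / sqrt 3 \<le> y" "0 \<le> half_width y \<longleftrightarrow> y \<le> 2 / sqrt 3"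
    by (auto simp: half_width_def field_simps)
  then show ?thesis unfolding ref_triangle_eq by auto
qed

text \<open>Fubini's theorem for the Lebesgue integral of \<open>f\<close> cut off outside the
  compact triangle; the Lebesgue integrals are then exchanged for \<open>integral\<close>.\<close>

lemma integral_ref_triangle:
  fixes f :: "real \<times> real \<Rightarrow> real"
  assumes f: "continuous_on UNIV f"
  shows "integral ref_triangle f
    = integral {-1 / sqrt 3..2 / sqrt 3} (\<lambda>y. integral {- half_width y..half_width y} (\<lambda>x. f (x, y)))"
proof -
  let ?I = "{-1 / sqrt 3..2 / sqrt 3}" and ?J = "\<lambda>y. {- half_width y..half_width y}"
  let ?F = "\<lambda>x y. indicator ref_triangle (x, y) *\<^sub>R f (x, y)"
  have int: "integrable lborel (\<lambda>p. indicator ref_triangle p *\<^sub>R f p)"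
    by (rule borel_integrable_compact[OF compact_ref_triangle continuous_on_subset[OF f]]) simp
  then have int2: "integrable (lborel \<Otimes>\<^sub>M lborel) (case_prod ?F)"
    by (simp add: lborel_prod case_prod_unfold)
  \<comment> \<open>Below the base the interval \<open>?J y\<close> is nonempty although the slice
    of the triangle is empty, so the indicator of \<open>?I\<close> has to stay.\<close>
  have inner: "(\<integral>x. ?F x y \<partial>lborel) = indicator ?I y *\<^sub>R integral (?J y) (\<lambda>x. f (x, y))" for y
  proof -
    have "continuous_on (?J y) (\<lambda>x. f (x, y))"
      by (rule continuous_on_compose2[OF f]) (auto intro!: continuous_intros)
    then have "set_integrable lborel (?J y) (\<lambda>x. f (x, y))"
      unfolding set_integrable_def by (intro borel_integrable_compact) auto
    then have *: "(LINT x:?J y|lborel. f (x, y)) = integral (?J y) (\<lambda>x. f (x, y))"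
      by (rule set_borel_integral_eq_integral)
    have "?F x y = indicator ?I y *\<^sub>R (indicator (?J y) x *\<^sub>R f (x, y))" for x
      by (simp only: indicator_def mem_ref_triangle) simp
    then have "(\<integral>x. ?F x y \<partial>lborel) = (\<integral>x. indicator ?I y *\<^sub>R (indicator (?J y) x *\<^sub>R f (x, y)) \<partial>lborel)"
      by (rule Bochner_Integration.integral_cong[OF refl])
    then have "(\<integral>x. ?F x y \<partial>lborel) = indicator ?I y *\<^sub>R (LINT x:?J y|lborel. f (x, y))"
      unfolding set_lebesgue_integral_def by simp
    then show ?thesis by (simp only: *)
  qed
  have "integral ref_triangle f = (LINT p:ref_triangle|lborel. f p)"
    by (rule set_borel_integral_eq_integral(2)[symmetric]) (simp add: set_integrable_def int[simplified])
  also have "\<dots> = (\<integral>p. case_prod ?F p \<partial>(lborel \<Otimes>\<^sub>M lborel))"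
    by (simp add: set_lebesgue_integral_def lborel_prod case_prod_unfold)
  also have "\<dots> = (\<integral>y. (\<integral>x. ?F x y \<partial>lborel) \<partial>lborel)"
    by (rule lborel_pair.integral_snd[OF int2, symmetric])
  also have "\<dots> = (LINT y:?I|lborel. integral (?J y) (\<lambda>x. f (x, y)))"
    unfolding inner set_lebesgue_integral_def ..
  also have "\<dots> = integral ?I (\<lambda>y. integral (?J y) (\<lambda>x. f (x, y)))"
    using lborel_pair.integrable_snd[OF int2]
    by (intro set_borel_integral_eq_integral) (simp only: inner set_integrable_def)
  finally show ?thesis .
qed

lemma has_integral_power_symmetric:
  fixes r :: real
  assumes "0 \<le> r"
  shows "((\<lambda>x. x ^ m) has_integral (r ^ (m + 1) - (- r) ^ (m + 1)) / real (m + 1)) {- r..r}"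
proof -
  have "((\<lambda>x. x ^ m) has_integral r ^ (m + 1) / real (m + 1) - (- r) ^ (m + 1) / real (m + 1)) {- r..r}"
  proof (rule fundamental_theorem_of_calculus)
    show "((\<lambda>x. x ^ (m + 1) / real (m + 1)) has_vector_derivative x ^ m) (at x within {- r..r})" for x
      unfolding has_real_derivative_iff_has_vector_derivative[symmetric]
      by (rule DERIV_cong, rule DERIV_cdivide, rule DERIV_pow) simp
  qed (use assms in simp)
  then show ?thesis by (simp only: diff_divide_distrib)
qed

lemma has_integral_half_width_power:
  "((\<lambda>y. half_width y ^ n) has_integral sqrt 3 / real (n + 1)) {-1 / sqrt 3..2 / sqrt 3}"
proof -
  \<comment> \<open>The factor \<open>- sqrt 3\<close> undoes the slope \<open>- 1 / sqrt 3\<close>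
    of \<open>half_width\<close>.\<close>
  let ?F = "\<lambda>y. - sqrt 3 * half_width y ^ (n + 1) / real (n + 1)"
  have "((\<lambda>y. half_width y ^ n) has_integral ?F (2 / sqrt 3) - ?F (-1 / sqrt 3)) {-1 / sqrt 3..2 / sqrt 3}"
  proof (rule fundamental_theorem_of_calculus)
    show "(?F has_vector_derivative half_width y ^ n) (at y within {-1 / sqrt 3..2 / sqrt 3})" for y
      unfolding has_real_derivative_iff_has_vector_derivative[symmetric]
      by (rule DERIV_cong, rule DERIV_cdivide, rule DERIV_cmult, rule DERIV_power,
          rule has_real_derivative_half_width) simp
  qed (rule order_trans[of _ 0]; simp)
  then show ?thesis by (simp add: half_width_def)
qed

definition moment :: "nat \<Rightarrow> nat \<Rightarrow> real" where
  "moment m n = (if even m then 2 * sqrt 3 / (real (m + 1) * real (m + n + 2)) else 0)"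

text \<open>The slice at height \<open>y\<close> contributes a multiple of
  \<open>half_width y ^ (m + n + 1)\<close>, which is zero for odd \<open>m\<close> by symmetry; a
  power integral over the heights remains.\<close>

lemma has_integral_moment:
  "((\<lambda>(x, y). x ^ m * half_width y ^ n) has_integral moment m n) ref_triangle"
proof -
  let ?f = "\<lambda>(x, y). x ^ m * half_width y ^ n"
  have cont: "continuous_on A ?f" for A
    unfolding case_prod_unfold half_width_def by (intro continuous_intros) simp
  have "integral {- half_width y..half_width y} (\<lambda>x. ?f (x, y))
      = (1 - (-1) ^ (m + 1)) / real (m + 1) * half_width y ^ (m + n + 1)"
    if "y \<in> {-1 / sqrt 3..2 / sqrt 3}" for y
  proof -
    have "0 \<le> half_width y" using that by (simp add: half_width_def field_simps)
    from has_integral_mult_left[OF has_integral_power_symmetric[OF this, of m], of "half_width y ^ n"]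
    have "integral {- half_width y..half_width y} (\<lambda>x. ?f (x, y))
        = (half_width y ^ (m + 1) - (- half_width y) ^ (m + 1)) / real (m + 1) * half_width y ^ n"
      unfolding prod.case by (rule integral_unique)
    also have "\<dots> = (1 - (-1) ^ (m + 1)) / real (m + 1) * half_width y ^ (m + n + 1)"
      unfolding power_minus[of "half_width y"] by (simp add: power_add algebra_simps)
    finally show ?thesis .
  qed
  then have "integral ref_triangle ?f = integral {-1 / sqrt 3..2 / sqrt 3}
      (\<lambda>y. (1 - (-1) ^ (m + 1)) / real (m + 1) * half_width y ^ (m + n + 1))"
    unfolding integral_ref_triangle[OF cont] by (intro integral_cong) simp
  also have "\<dots> = (1 - (-1) ^ (m + 1)) / real (m + 1) * (sqrt 3 / real (m + n + 1 + 1))"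
    by (intro integral_unique has_integral_mult_right has_integral_half_width_power)
  also have "\<dots> = moment m n"
    by (simp add: moment_def)
  finally have "integral ref_triangle ?f = moment m n" .
  moreover have "?f integrable_on ref_triangle"
    using borel_integrable_compact[OF compact_ref_triangle cont]
    by (intro set_borel_integral_eq_integral) (simp add: set_integrable_def)
  ultimately show ?thesis by (simp add: has_integral_iff)
qed

lemma ref_area: "ref_area = sqrt 3"
proof -
  have "set_integrable lborel ref_triangle (\<lambda>_. 1 :: real)"
    unfolding set_integrable_def
    by (rule borel_integrable_compact[OF compact_ref_triangle]) simp
  then have "(LINT p:ref_triangle|lborel. 1 :: real) = integral ref_triangle (\<lambda>_. 1)"
    by (rule set_borel_integral_eq_integral)
  then have "ref_area = integral ref_triangle (\<lambda>_. 1)"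
    by (simp add: ref_area_def set_lebesgue_integral_def)
  moreover have "((\<lambda>_. 1) has_integral sqrt 3) ref_triangle"
    using has_integral_moment[of 0 0] by (simp add: moment_def case_prod_unfold)
  ultimately show ?thesis by (simp add: integral_unique)
qed

section \<open>The Dubiner modes of degree at most two\<close>

lemma jacobi_0 [simp]: "jacobi \<alpha> \<beta> 0 s = 1"
  by (simp add: jacobi_def)

lemma jacobi_1: "jacobi \<alpha> \<beta> 1 s = (1 + real \<alpha>) * (s + 1) / 2 + (1 + real \<beta>) * (s - 1) / 2"
  by (simp add: jacobi_def)

text \<open>The two cases of degree 2 that occur: \<open>v = 2\<close> in the factor of
  \<open>a\<close>, and \<open>w = 2\<close> in the factor of \<open>b\<close>, which forces
  \<open>v = 0\<close> and hence the first parameter 1.\<close>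

lemma jacobi_2:
  "jacobi 0 0 2 s = (3 * s\<^sup>2 - 1) / 2"
  "jacobi 1 0 2 s = (5 * s\<^sup>2 + 2 * s - 1) / 2"
  by (simp_all add: jacobi_def numeral_2_eq_2 binomial_Suc_Suc field_simps)

lemma integral_eq_antiderivative:
  fixes f F :: "real \<Rightarrow> real"
  assumes "a \<le> b" "\<And>t. (F has_real_derivative f t) (at t)"
  shows "integral {a..b} f = F b - F a"
  using assms
  by (intro integral_unique fundamental_theorem_of_calculus)
     (auto simp flip: has_real_derivative_iff_has_vector_derivative
           intro: has_field_derivative_at_within)

text \<open>Squared norms of all Jacobi factors of the six modes: the parameters
  \<open>(0, 0)\<close> belong to \<open>a\<close>, and \<open>(2 * v + 1, 0)\<close> with
  \<open>v + w \<le> 2\<close> to \<open>b\<close>. Nonconstant integrands get an explicit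
  antiderivative.\<close>

lemma integral_jacobi_square:
  "integral {-1..1} (\<lambda>t. (jacobi 0 0 0 t)\<^sup>2 * (1 - t) ^ 0 * (1 + t) ^ 0) = 2"
  "integral {-1..1} (\<lambda>t. (jacobi 0 0 1 t)\<^sup>2 * (1 - t) ^ 0 * (1 + t) ^ 0) = 2 / 3"
  "integral {-1..1} (\<lambda>t. (jacobi 0 0 2 t)\<^sup>2 * (1 - t) ^ 0 * (1 + t) ^ 0) = 2 / 5"
  "integral {-1..1} (\<lambda>t. (jacobi 1 0 0 t)\<^sup>2 * (1 - t) ^ 1 * (1 + t) ^ 0) = 2"
  "integral {-1..1} (\<lambda>t. (jacobi 1 0 1 t)\<^sup>2 * (1 - t) ^ 1 * (1 + t) ^ 0) = 1"
  "integral {-1..1} (\<lambda>t. (jacobi 1 0 2 t)\<^sup>2 * (1 - t) ^ 1 * (1 + t) ^ 0) = 2 / 3"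
  "integral {-1..1} (\<lambda>t. (jacobi 3 0 0 t)\<^sup>2 * (1 - t) ^ 3 * (1 + t) ^ 0) = 4"
  "integral {-1..1} (\<lambda>t. (jacobi 3 0 1 t)\<^sup>2 * (1 - t) ^ 3 * (1 + t) ^ 0) = 8 / 3"
  "integral {-1..1} (\<lambda>t. (jacobi 5 0 0 t)\<^sup>2 * (1 - t) ^ 5 * (1 + t) ^ 0) = 32 / 3"
proof -
  note jac = jacobi_0 jacobi_1[unfolded One_nat_def] jacobi_2[unfolded One_nat_def]
  have I: "integral {-1..1} f = v"
    if "\<And>t. (F has_real_derivative f t) (at t)" "F 1 - F (-1) = v" for f F :: "real \<Rightarrow> real" and v
    using integral_eq_antiderivative[of "-1" 1 F f] that by simp
  show "integral {-1..1} (\<lambda>t. (jacobi 0 0 0 t)\<^sup>2 * (1 - t) ^ 0 * (1 + t) ^ 0) = 2"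
    by (simp add: jac)
  show "integral {-1..1} (\<lambda>t. (jacobi 0 0 1 t)\<^sup>2 * (1 - t) ^ 0 * (1 + t) ^ 0) = 2 / 3"
    by (rule I[of "\<lambda>t. t ^ 3 / 3"]; (rule derivative_eq_intros refl | simp add: jac)+)
      (simp flip: add_divide_distrib)
  show "integral {-1..1} (\<lambda>t. (jacobi 0 0 2 t)\<^sup>2 * (1 - t) ^ 0 * (1 + t) ^ 0) = 2 / 5"
    by (rule I[of "\<lambda>t. (9 * t ^ 5 / 5 - 2 * t ^ 3 + t) / 4"]; (rule derivative_eq_intros refl | simp add: jac)+)
      (simp add: field_simps power2_eq_square eval_nat_numeral)
  show "integral {-1..1} (\<lambda>t. (jacobi 1 0 0 t)\<^sup>2 * (1 - t) ^ 1 * (1 + t) ^ 0) = 2"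
    by (rule I[of "\<lambda>t. t - t\<^sup>2 / 2"]; (rule derivative_eq_intros refl | simp add: jac)+)
  show "integral {-1..1} (\<lambda>t. (jacobi 1 0 1 t)\<^sup>2 * (1 - t) ^ 1 * (1 + t) ^ 0) = 1"
    by (rule I[of "\<lambda>t. (- 9 * t ^ 4 / 4 + t ^ 3 + 5 * t\<^sup>2 / 2 + t) / 4"]; (rule derivative_eq_intros refl | simp add: jac)+)
      (simp add: jacobi_1 field_simps power2_eq_square eval_nat_numeral)
  show "integral {-1..1} (\<lambda>t. (jacobi 1 0 2 t)\<^sup>2 * (1 - t) ^ 1 * (1 + t) ^ 0) = 2 / 3"
    by (rule I[of "\<lambda>t. (- 25 * t ^ 6 / 6 + t ^ 5 + 13 * t ^ 4 / 2 - 2 * t ^ 3 / 3 - 5 * t\<^sup>2 / 2 + t) / 4"];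
        (rule derivative_eq_intros refl | simp add: jac)+)
      (simp add: jacobi_2 field_simps power2_eq_square eval_nat_numeral)
  \<comment> \<open>From here on the antiderivatives are written in \<open>1 - t\<close>, the base
    of the weight; for \<open>jacobi 3 0 1\<close> the integrand is
    \<open>u ^ 3 * (8 - 5 * u) ^ 2 / 4\<close> with \<open>u = 1 - t\<close>.\<close>
  show "integral {-1..1} (\<lambda>t. (jacobi 3 0 0 t)\<^sup>2 * (1 - t) ^ 3 * (1 + t) ^ 0) = 4"
    by (rule I[of "\<lambda>t. - ((1 - t) ^ 4 / 4)"]; (rule derivative_eq_intros refl | simp add: jac)+)
  show "integral {-1..1} (\<lambda>t. (jacobi 3 0 1 t)\<^sup>2 * (1 - t) ^ 3 * (1 + t) ^ 0) = 8 / 3"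
    by (rule I[of "\<lambda>t. - (16 * (1 - t) ^ 4 - 16 * (1 - t) ^ 5 + 25 * (1 - t) ^ 6 / 6) / 4"];
        (rule derivative_eq_intros refl | simp add: jac)+)
      (simp add: jacobi_1 field_simps power2_eq_square eval_nat_numeral)
  show "integral {-1..1} (\<lambda>t. (jacobi 5 0 0 t)\<^sup>2 * (1 - t) ^ 5 * (1 + t) ^ 0) = 32 / 3"
    by (rule I[of "\<lambda>t. - ((1 - t) ^ 6 / 6)"]; (rule derivative_eq_intros refl | simp add: jac)+)
qed

lemma jacobi_normalised_values:
  "jacobi_normalised 0 0 0 s = 1 / sqrt 2"
  "jacobi_normalised 0 0 1 s = sqrt 3 * s / sqrt 2"
  "jacobi_normalised 0 0 2 s = sqrt 5 * (3 * s\<^sup>2 - 1) / (2 * sqrt 2)"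
  "jacobi_normalised 1 0 0 s = 1 / sqrt 2"
  "jacobi_normalised 1 0 1 s = (3 * s + 1) / 2"
  "jacobi_normalised 1 0 2 s = sqrt 3 * (5 * s\<^sup>2 + 2 * s - 1) / (2 * sqrt 2)"
  "jacobi_normalised 3 0 0 s = 1 / 2"
  "jacobi_normalised 3 0 1 s = sqrt 3 * (5 * s + 3) / (4 * sqrt 2)"
  "jacobi_normalised 5 0 0 s = sqrt 3 / (4 * sqrt 2)"
proof -
  have s8: "sqrt 8 = 2 * sqrt 2" using real_sqrt_mult[of 4 2] by simp
  have s32: "sqrt 32 = 4 * sqrt 2" using real_sqrt_mult[of 16 2] by simp
  show "jacobi_normalised 0 0 0 s = 1 / sqrt 2"
    "jacobi_normalised 0 0 1 s = sqrt 3 * s / sqrt 2"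
    "jacobi_normalised 0 0 2 s = sqrt 5 * (3 * s\<^sup>2 - 1) / (2 * sqrt 2)"
    "jacobi_normalised 1 0 0 s = 1 / sqrt 2"
    "jacobi_normalised 1 0 1 s = (3 * s + 1) / 2"
    "jacobi_normalised 1 0 2 s = sqrt 3 * (5 * s\<^sup>2 + 2 * s - 1) / (2 * sqrt 2)"
    "jacobi_normalised 3 0 0 s = 1 / 2"
    "jacobi_normalised 3 0 1 s = sqrt 3 * (5 * s + 3) / (4 * sqrt 2)"
    "jacobi_normalised 5 0 0 s = sqrt 3 / (4 * sqrt 2)"
    unfolding jacobi_normalised_def integral_jacobi_square
    unfolding jacobi_0 jacobi_1 jacobi_2 real_sqrt_divide s8 s32
    by (simp_all add: field_simps)
qed

section \<open>Explicit polynomials for the six modes\<close>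

lemma mode_degrees_2:
  "mode_degrees 2 1 = (0, 0)" "mode_degrees 2 2 = (0, 1)" "mode_degrees 2 3 = (0, 2)"
  "mode_degrees 2 4 = (1, 0)" "mode_degrees 2 5 = (1, 1)" "mode_degrees 2 6 = (2, 0)"
proof -
  \<comment> \<open>Only six pairs satisfy the degree bound, so uniqueness reduces to testing the
    numbering equation on each of them.\<close>
  have le: "v + w \<le> 2 \<longleftrightarrow> (v, w) \<in> {(0, 0), (0, 1), (0, 2), (1, 0), (1, 1), (2, 0)}" for v w :: nat
    by auto
  show "mode_degrees 2 1 = (0, 0)" "mode_degrees 2 2 = (0, 1)" "mode_degrees 2 3 = (0, 2)"
    "mode_degrees 2 4 = (1, 0)" "mode_degrees 2 5 = (1, 1)" "mode_degrees 2 6 = (2, 0)"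
    unfolding mode_degrees_def le by (rule the_equality; auto)+
qed

definition poly_eval :: "(real \<times> nat \<times> nat) list \<Rightarrow> real \<Rightarrow> real \<Rightarrow> real" where
  "poly_eval ts x r = (\<Sum>(c, m, n)\<leftarrow>ts. c * (x ^ m * r ^ n))"

text \<open>The triple \<open>(c, m, n)\<close> encodes the term \<open>c * x ^ m * r ^ n\<close>. Modes are numbered from 0 here and
rescaled by \<open>3 powr (1/4)\<close>, which keeps fourth roots out of the coefficients.\<close>

definition mode_terms :: "(real \<times> nat \<times> nat) list list" where
  "mode_terms =
    [[(1, 0, 0)],
     [(2 * sqrt 2, 0, 0), (-3 * sqrt 2, 0, 1)],
     [(3 * sqrt 3, 0, 0), (-12 * sqrt 3, 0, 1), (10 * sqrt 3, 0, 2)],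
     [(sqrt 2 * sqrt 3, 1, 0)],
     [(12, 1, 0), (-15, 1, 1)],
     [(3 * sqrt 3 * sqrt 5 / 2, 2, 0), (- sqrt 3 * sqrt 5 / 2, 0, 2)]]"

definition mode :: "nat \<Rightarrow> real \<Rightarrow> real \<Rightarrow> real" where
  "mode i = poly_eval (mode_terms ! i)"

lemma less_6_iff: "i < 6 \<longleftrightarrow> i \<in> {0, 1, 2, 3, 4, 5 :: nat}"
  by auto

lemma all_less_6: "(\<forall>i<6. P i) \<longleftrightarrow> P 0 \<and> P 1 \<and> P 2 \<and> P 3 \<and> P 4 \<and> P (5 :: nat)"
  unfolding less_6_iff by blast

lemma sum_less_6: "(\<Sum>i<6. f i) = f 0 + f 1 + f 2 + f 3 + f 4 + f (5 :: nat)"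
  by (simp add: eval_nat_numeral)

lemma mode_simps:
  "mode 0 x r = 1"
  "mode 1 x r = sqrt 2 * (2 - 3 * r)"
  "mode 2 x r = sqrt 3 * (3 - 12 * r + 10 * r\<^sup>2)"
  "mode 3 x r = sqrt 2 * sqrt 3 * x"
  "mode 4 x r = x * (12 - 15 * r)"
  "mode 5 x r = sqrt 3 * sqrt 5 * (3 * x\<^sup>2 - r\<^sup>2) / 2"
  by (simp_all add: mode_def poly_eval_def mode_terms_def field_simps)

text \<open>For use as a rewrite rule: it cancels a repeated root at the head of a right-nested
  product, where \<open>sqrt a * sqrt a\<close> is not a subterm.\<close>

lemma sqrt_mult_self_left: "0 \<le> a \<Longrightarrow> sqrt a * (sqrt a * z) = a * z"
  by (simp flip: mult.assoc)

lemma dubiner_collapsed: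
  assumes "mode_degrees k i = (v, w)"
  shows "dubiner k i (x, y) = 2 * (2 * half_width y) ^ v * jacobi_normalised 0 0 v (x / half_width y)
    * jacobi_normalised (2 * v + 1) 0 w (1 - 2 * half_width y) / 3 powr (1/4)"
proof -
  have a: "3 * x / (2 - sqrt 3 * y) = x / half_width y"
    unfolding half_width_def by simp
  have b: "(2 * sqrt 3 * y - 1) / 3 = 1 - 2 * half_width y"
    unfolding half_width_def by (simp add: diff_divide_distrib)
  show ?thesis
    unfolding dubiner_def Let_def prod.case assms a b by simp
qed

text \<open>On the line \<open>half_width y = 0\<close> division by zero makes \<open>a\<close>
  zero, and the factor \<open>(1 - b) ^ v\<close> kills every mode with \<open>v > 0\<close>; the
  polynomials of these modes vanish on that line only at \<open>x = 0\<close>. The triangle meets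
  the line only there, so the equation is available on all of it.\<close>

lemma dubiner_eq_mode:
  assumes "i < 6" "x = 0 \<or> half_width y \<noteq> 0"
  shows "dubiner 2 (i + 1) (x, y) = mode i x (half_width y) / 3 powr (1/4)"
proof -
  define r where "r = half_width y"
  have r: "x = 0 \<or> r \<noteq> 0" using assms r_def by simp
  have one: "0 + 1 = (1 :: nat)" "1 + 1 = (2 :: nat)" "2 + 1 = (3 :: nat)" "3 + 1 = (4 :: nat)"
    "4 + 1 = (5 :: nat)" "5 + 1 = (6 :: nat)" "2 * 0 + 1 = (1 :: nat)" "2 * 1 + 1 = (3 :: nat)"
    "2 * 2 + 1 = (5 :: nat)" by simp_all
  have "\<forall>i<6. dubiner 2 (i + 1) (x, y) = mode i x r / 3 powr (1/4)"
    unfolding all_less_6 one mode_degrees_2[THEN dubiner_collapsed]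
      jacobi_normalised_values r_def[symmetric] mode_simps
    using r by (auto simp: field_simps power2_eq_square sqrt_mult_self_left)
  then show ?thesis using assms r_def by simp
qed

section \<open>Orthonormality of the modes\<close>

lemma has_integral_poly_eval_product:
  "((\<lambda>(x, y). poly_eval ps x (half_width y) * poly_eval qs x (half_width y)) has_integral
    (\<Sum>(c, m, n)\<leftarrow>ps. \<Sum>(c', m', n')\<leftarrow>qs. c * c' * moment (m + m') (n + n'))) ref_triangle"
proof (induction ps)
  case Nil
  show ?case by (simp add: poly_eval_def case_prod_unfold)
next
  case (Cons p ps)
  obtain c m n where p: "p = (c, m, n)" by (cases p)
  have "((\<lambda>(x, y). c * (x ^ m * half_width y ^ n) * poly_eval qs x (half_width y)) has_integral
      (\<Sum>(c', m', n')\<leftarrow>qs. c * c' * moment (m + m') (n + n'))) ref_triangle"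
  proof (induction qs)
    case Nil
    show ?case by (simp add: poly_eval_def case_prod_unfold)
  next
    case (Cons q qs)
    obtain c' m' n' where q: "q = (c', m', n')" by (cases q)
    \<comment> \<open>A product of two terms is a single monomial, integrated by one moment; the two
      inductions spell out bilinearity.\<close>
    have "((\<lambda>z. c * c' * (\<lambda>(x, y). x ^ (m + m') * half_width y ^ (n + n')) z) has_integral
        c * c' * moment (m + m') (n + n')) ref_triangle"
      by (intro has_integral_mult_right has_integral_moment)
    from has_integral_add[OF this Cons.IH] show ?case
      by (simp add: q poly_eval_def case_prod_unfold power_add algebra_simps)
  qed
  from has_integral_add[OF this Cons.IH] show ?case
    by (simp add: p poly_eval_def case_prod_unfold algebra_simps)
qed

lemma num_modes_2: "num_modes 2 = 6"
  by (simp add: num_modes_def)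

lemma modal_mass_2: "modal_mass 2 = 1\<^sub>m 6"
proof -
  let ?g = "\<lambda>i j. \<Sum>(c, m, n)\<leftarrow>mode_terms ! i. \<Sum>(c', m', n')\<leftarrow>mode_terms ! j.
      c * c' * moment (m + m') (n + n')"
  have "integral ref_triangle (\<lambda>p. dubiner 2 (i + 1) p * dubiner 2 (j + 1) p) = ?g i j / sqrt 3"
    if "i < 6" "j < 6" for i j
  proof -
    \<comment> \<open>The two scale factors \<open>3 powr (1/4)\<close> multiply to
      \<open>sqrt 3\<close>, the factor that every nonzero moment carries.\<close>
    have sq: "3 powr (1/4) * 3 powr (1/4) = sqrt (3 :: real)"
      by (simp flip: powr_add add: powr_half_sqrt)
    have "integral ref_triangle (\<lambda>p. dubiner 2 (i + 1) p * dubiner 2 (j + 1) p) =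
        integral ref_triangle (\<lambda>p. (\<lambda>(x, y). mode i x (half_width y) * mode j x (half_width y)) p / sqrt 3)"
    proof (rule integral_cong)
      fix p assume "p \<in> ref_triangle"
      moreover obtain x y where "p = (x, y)" by (cases p)
      ultimately show "dubiner 2 (i + 1) p * dubiner 2 (j + 1) p =
          (\<lambda>(x, y). mode i x (half_width y) * mode j x (half_width y)) p / sqrt 3"
        using that by (subst (1 2) \<open>p = (x, y)\<close>, subst (1 2) dubiner_eq_mode)
          (auto simp: ref_triangle_eq simp flip: sq)
    qed
    also have "\<dots> = ?g i j / sqrt 3"
      unfolding mode_def by (intro integral_unique has_integral_divide has_integral_poly_eval_product)
    finally show ?thesis .
  qed
  moreover have "\<forall>i<6. \<forall>j<6. ?g i j / sqrt 3 = (if i = j then 1 else 0)"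
    unfolding all_less_6 by (simp add: mode_terms_def moment_def sqrt_mult_self_left)
  ultimately show ?thesis
    by (intro eq_matI) (simp_all add: modal_mass_def num_modes_2)
qed

section \<open>Modal matrices\<close>

lemma modes_independent:
  assumes "\<And>x r. \<bar>x\<bar> < r \<Longrightarrow> r < 1 \<Longrightarrow> (\<Sum>i<6. c i * mode i x r) = 0"
  shows "\<forall>i<6. c i = 0"
proof -
  \<comment> \<open>Absorbing the square roots into the unknowns leaves a linear system with
    rational coefficients.\<close>
  define d1 d2 d3 d5 where d: "d1 = sqrt 2 * c 1" "d2 = sqrt 3 * c 2" "d3 = sqrt 2 * sqrt 3 * c 3"
    "d5 = sqrt 3 * sqrt 5 * c 5"
  have "(\<Sum>i<6. c i * mode i x r) = c 0 + (2 - 3 * r) * d1 + (3 - 12 * r + 10 * r\<^sup>2) * d2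
      + x * d3 + x * (12 - 15 * r) * c 4 + (3 * x\<^sup>2 - r\<^sup>2) / 2 * d5" for x r
    by (simp add: sum_less_6 mode_simps[unfolded One_nat_def] d algebra_simps)
  then have eq: "c 0 + (2 - 3 * r) * d1 + (3 - 12 * r + 10 * r\<^sup>2) * d2
      + x * d3 + x * (12 - 15 * r) * c 4 + (3 * x\<^sup>2 - r\<^sup>2) / 2 * d5 = 0"
    if "\<bar>x\<bar> < r" "r < 1" for x r
    using assms[OF that] by simp
  \<comment> \<open>The six sample points determine a quadratic polynomial: one that vanishes at the
    three points with \<open>x = 0\<close> is divisible by \<open>x\<close>, and its linear cofactor
    vanishes at the other three, which are not collinear.\<close>
  have "c 0 = 0 \<and> d1 = 0 \<and> d2 = 0 \<and> d3 = 0 \<and> c 4 = 0 \<and> d5 = 0"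
    using eq[of 0 "1/4"] eq[of 0 "1/2"] eq[of 0 "3/4"] eq[of "1/4" "1/2"] eq[of "-1/4" "1/2"]
      eq[of "1/4" "3/4"]
    by (simp add: power2_eq_square field_simps)
  then show ?thesis
    unfolding all_less_6 by (simp add: d)
qed

text \<open>\<open>modes_independent\<close> gives the uniqueness that the definite description
  demands. The scale factor \<open>3 powr (1/4)\<close> is common to all modes, so expansions in the
  polynomials \<open>mode i\<close> suffice.\<close>

lemma modal_matrix_2_eqI:
  assumes B: "B \<in> carrier_mat 6 6"
    and T: "\<And>j x y. j < 6 \<Longrightarrow> \<bar>x\<bar> < half_width y \<Longrightarrow> half_width y < 1 \<Longrightarrow>
      T (dubiner 2 (j + 1)) (x, y) = (\<Sum>i<6. B $$ (i, j) * mode i x (half_width y)) / 3 powr (1/4)"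
  shows "modal_matrix 2 T = B"
  unfolding modal_matrix_def num_modes_2
proof (rule the_equality)
  have dub: "(\<Sum>i<6. A $$ (i, j) * dubiner 2 (i + 1) (x, y))
      = (\<Sum>i<6. A $$ (i, j) * mode i x (half_width y)) / 3 powr (1/4)"
    if "\<bar>x\<bar> < half_width y" for A :: "real mat" and j x y
    unfolding sum_divide_distrib
    by (intro sum.cong refl, subst dubiner_eq_mode) (use that in auto)
  show "B \<in> carrier_mat 6 6 \<and> (\<forall>j<6. \<forall>p\<in>interior ref_triangle.
      T (dubiner 2 (j + 1)) p = (\<Sum>i<6. B $$ (i, j) * dubiner 2 (i + 1) p))"
    using B T dub by (auto simp: interior_ref_triangle)
  fix A assume A: "A \<in> carrier_mat 6 6 \<and> (\<forall>j<6. \<forall>p\<in>interior ref_triangle.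
      T (dubiner 2 (j + 1)) p = (\<Sum>i<6. A $$ (i, j) * dubiner 2 (i + 1) p))"
  have "\<forall>i<6. A $$ (i, j) - B $$ (i, j) = 0" if j: "j < 6" for j
  proof (rule modes_independent)
    fix x r :: real assume xr: "\<bar>x\<bar> < r" "r < 1"
    define y where "y = (2 - 3 * r) / sqrt 3"
    have r: "r = half_width y" by (simp add: y_def half_width_def)
    have "(x, y) \<in> interior ref_triangle" using xr by (simp add: r interior_ref_triangle)
    then have "(\<Sum>i<6. A $$ (i, j) * mode i x r) = (\<Sum>i<6. B $$ (i, j) * mode i x r)"
      using A T[OF j, of x y] dub[of x y A j] j xr by (simp add: r)
    then show "(\<Sum>i<6. (A $$ (i, j) - B $$ (i, j)) * mode i x r) = 0"
      by (simp add: algebra_simps sum_subtractf)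
  qed
  then show "A = B" using A B by (intro eq_matI) auto
qed

section \<open>Matrices of the derivatives and of the symmetries\<close>

lemma has_real_derivative_mode_x:
  assumes "j < 6"
  shows "((\<lambda>t. mode j t r) has_real_derivative
    [0, 0, 0, sqrt 2 * sqrt 3, 12 - 15 * r, 3 * sqrt 3 * sqrt 5 * x] ! j) (at x)"
proof -
  have "\<forall>j<6. ((\<lambda>t. mode j t r) has_real_derivative
      [0, 0, 0, sqrt 2 * sqrt 3, 12 - 15 * r, 3 * sqrt 3 * sqrt 5 * x] ! j) (at x)"
    unfolding all_less_6 mode_simps
    by (auto intro!: derivative_eq_intros)
  then show ?thesis using assms by blast
qed

lemma has_real_derivative_mode_r:
  assumes "j < 6"
  shows "(mode j x has_real_derivative
    [0, - 3 * sqrt 2, sqrt 3 * (20 * r - 12), 0, - 15 * x, - sqrt 3 * sqrt 5 * r] ! j) (at r)"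
proof -
  have "\<forall>j<6. ((\<lambda>r. mode j x r) has_real_derivative
      [0, - 3 * sqrt 2, sqrt 3 * (20 * r - 12), 0, - 15 * x, - sqrt 3 * sqrt 5 * r] ! j) (at r)"
    unfolding all_less_6 mode_simps
    by (auto intro!: derivative_eq_intros simp: algebra_simps)
  then show ?thesis using assms by blast
qed

text \<open>Column \<open>j\<close> expands the image of mode \<open>j\<close>. Rows 2, 4 and 5
  vanish here and in \<open>Dy_matrix\<close>: they belong to the modes of degree two, and a
  derivative has degree at most one.\<close>

definition Dx_matrix :: "real mat" where
  "Dx_matrix = mat_of_rows_list 6
    [[0, 0, 0, sqrt 2 * sqrt 3, 2, 0],
     [0, 0, 0, 0, 5 * sqrt 2 / 2, 0],
     [0, 0, 0, 0, 0, 0],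
     [0, 0, 0, 0, 0, 3 * sqrt 2 * sqrt 5 / 2],
     [0, 0, 0, 0, 0, 0],
     [0, 0, 0, 0, 0, 0]]"

definition Dy_matrix :: "real mat" where
  "Dy_matrix = mat_of_rows_list 6
    [[0, sqrt 2 * sqrt 3, - 4 / 3, 0, 0, 2 * sqrt 5 / 3],
     [0, 0, 10 * sqrt 2 / 3, 0, 0, - sqrt 2 * sqrt 5 / 6],
     [0, 0, 0, 0, 0, 0],
     [0, 0, 0, 0, 5 * sqrt 2 / 2, 0],
     [0, 0, 0, 0, 0, 0],
     [0, 0, 0, 0, 0, 0]]"

text \<open>The rotation preserves the total degree and the inner product, so the orthonormal modes
  split into orthogonal blocks with the indices 0, then 1 and 3, then 2, 4 and 5.\<close>

definition rotation_matrix :: "real mat" where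
  "rotation_matrix = mat_of_rows_list 6
    [[1, 0, 0, 0, 0, 0],
     [0, - 1 / 2, 0, - sqrt 3 / 2, 0, 0],
     [0, 0, 1 / 3, 0, sqrt 3 / 3, sqrt 5 / 3],
     [0, sqrt 3 / 2, 0, - 1 / 2, 0, 0],
     [0, 0, - sqrt 3 / 3, 0, - 1 / 2, sqrt 3 * sqrt 5 / 6],
     [0, 0, sqrt 5 / 3, 0, - sqrt 3 * sqrt 5 / 6, 1 / 6]]"

text \<open>The signs are the parities of the modes in \<open>x\<close>, that is
  \<open>(- 1) ^ v\<close>.\<close>

definition reflection_matrix :: "real mat" where
  "reflection_matrix = mat_of_rows_list 6
    [[1, 0, 0, 0, 0, 0],
     [0, 1, 0, 0, 0, 0],
     [0, 0, 1, 0, 0, 0],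
     [0, 0, 0, - 1, 0, 0],
     [0, 0, 0, 0, - 1, 0],
     [0, 0, 0, 0, 0, 1]]"

lemma mat_of_rows_list_carrier_6:
  "length rs = 6 \<Longrightarrow> mat_of_rows_list 6 rs \<in> carrier_mat 6 6"
  by (simp add: mat_of_rows_list_def)

lemma Dx_matrix_carrier: "Dx_matrix \<in> carrier_mat 6 6"
  and Dy_matrix_carrier: "Dy_matrix \<in> carrier_mat 6 6"
  and rotation_matrix_carrier: "rotation_matrix \<in> carrier_mat 6 6"
  and reflection_matrix_carrier: "reflection_matrix \<in> carrier_mat 6 6"
  and Q_extended_carrier: "Q_extended q\<^sub>0 q\<^sub>1 \<in> carrier_mat 6 6"
  unfolding Dx_matrix_def Dy_matrix_def rotation_matrix_def reflection_matrix_def Q_extended_def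
  by (rule mat_of_rows_list_carrier_6, simp)+

lemma modal_Dx_2: "modal_Dx 2 = Dx_matrix"
  unfolding modal_Dx_def
proof (rule modal_matrix_2_eqI)
  fix j :: nat and x y :: real
  assume j: "j < 6" and xy: "\<bar>x\<bar> < half_width y"
  let ?r = "half_width y" and ?D = "\<lambda>r. [0, 0, 0, sqrt 2 * sqrt 3, 12 - 15 * r, 3 * sqrt 3 * sqrt 5 * x]"
  \<comment> \<open>Along a horizontal line \<open>half_width y\<close> is a fixed positive number,
    so the mode agrees with its polynomial on the entire line.\<close>
  have "(\<lambda>t. dubiner 2 (j + 1) (t, y)) = (\<lambda>t. mode j t ?r / 3 powr (1/4))"
    using j xy by (intro ext dubiner_eq_mode) auto
  then have "partial_x (dubiner 2 (j + 1)) (x, y) = ?D ?r ! j / 3 powr (1/4)"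
    unfolding partial_x_def prod.case
    by (simp only:) (intro DERIV_imp_deriv DERIV_cdivide has_real_derivative_mode_x j)
  moreover have "\<forall>j<6. ?D r ! j = (\<Sum>i<6. Dx_matrix $$ (i, j) * mode i x r)" for r
    unfolding all_less_6 sum_less_6 mode_simps Dx_matrix_def
    by (simp add: mat_of_rows_list_def sqrt_mult_self_left algebra_simps)
  ultimately show "partial_x (dubiner 2 (j + 1)) (x, y) =
      (\<Sum>i<6. Dx_matrix $$ (i, j) * mode i x ?r) / 3 powr (1/4)"
    using j by simp
qed (rule Dx_matrix_carrier)

lemma modal_Dy_2: "modal_Dy 2 = Dy_matrix"
  unfolding modal_Dy_def
proof (rule modal_matrix_2_eqI)
  fix j :: nat and x y :: real
  assume j: "j < 6" and xy: "\<bar>x\<bar> < half_width y"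
  let ?r = "half_width y"
    and ?D = "\<lambda>r. [0, - 3 * sqrt 2, sqrt 3 * (20 * r - 12), 0, - 15 * x, - sqrt 3 * sqrt 5 * r]"
  \<comment> \<open>A vertical line crosses the zero of \<open>half_width\<close>, so here the
    agreement is established in a neighbourhood of \<open>y\<close>, which determines the
    derivative.\<close>
  have "open {t. 0 < half_width t}"
    unfolding half_width_def by (intro open_Collect_less continuous_intros) simp_all
  then have "eventually (\<lambda>t. 0 < half_width t) (nhds y)"
    using xy by (intro eventually_nhds_in_open[of "{t. 0 < half_width t}", simplified]) auto
  then have "eventually (\<lambda>t. dubiner 2 (j + 1) (x, t) = mode j x (half_width t) / 3 powr (1/4)) (nhds y)"
    by eventually_elim (intro dubiner_eq_mode, use j in auto)
  then have "partial_y (dubiner 2 (j + 1)) (x, y)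
      = deriv (\<lambda>t. mode j x (half_width t) / 3 powr (1/4)) y"
    unfolding partial_y_def prod.case by (intro deriv_cong_ev refl)
  also have "\<dots> = ?D ?r ! j * (- 1 / sqrt 3) / 3 powr (1/4)"
    by (intro DERIV_imp_deriv DERIV_cdivide DERIV_chain2[where g = half_width]
        has_real_derivative_mode_r has_real_derivative_half_width j)
  also have "\<forall>j<6. ?D r ! j * (- 1 / sqrt 3) = (\<Sum>i<6. Dy_matrix $$ (i, j) * mode i x r)" for r
    unfolding all_less_6 sum_less_6 mode_simps Dy_matrix_def
    by (simp add: mat_of_rows_list_def sqrt_mult_self_left field_simps)
  then have "?D ?r ! j * (- 1 / sqrt 3) = (\<Sum>i<6. Dy_matrix $$ (i, j) * mode i x ?r)"
    using j by blast
  finally show "partial_y (dubiner 2 (j + 1)) (x, y) =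
      (\<Sum>i<6. Dy_matrix $$ (i, j) * mode i x ?r) / 3 powr (1/4)" .
qed (rule Dy_matrix_carrier)

lemma rotation_collapsed:
  obtains x' y' where "rotation (x, y) = (x', y')"
    "x' = (3 * half_width y - x) / 2 - 1" "half_width y' = 1 - (x + half_width y) / 2"
proof -
  have "cos (2 * pi / 3) = - 1 / 2" "sin (2 * pi / 3) = sqrt 3 / 2"
    using cos_120 sin_120 by (simp_all add: mult.commute)
  then have "rotation (x, y) = (- x / 2 - sqrt 3 / 2 * y, sqrt 3 / 2 * x - y / 2)"
    by (simp add: rotation_def)
  then show ?thesis
    by (rule that) (simp_all add: half_width_def field_simps)
qed

lemma modal_rotation_2: "modal_rotation 2 = rotation_matrix"
  unfolding modal_rotation_def
proof (rule modal_matrix_2_eqI)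
  fix j :: nat and x y :: real
  assume j: "j < 6" and xy: "\<bar>x\<bar> < half_width y" "half_width y < 1"
  obtain x' y' where rot: "rotation (x, y) = (x', y')"
    and xy': "x' = (3 * half_width y - x) / 2 - 1" "half_width y' = 1 - (x + half_width y) / 2"
    by (rule rotation_collapsed)
  have "\<forall>j<6. mode j ((3 * r - x) / 2 - 1) (1 - (x + r) / 2) = (\<Sum>i<6. rotation_matrix $$ (i, j) * mode i x r)" for r
    unfolding all_less_6 sum_less_6 mode_simps rotation_matrix_def
    by (simp add: mat_of_rows_list_def sqrt_mult_self_left power2_eq_square field_simps)
  then have "mode j x' (half_width y') = (\<Sum>i<6. rotation_matrix $$ (i, j) * mode i x (half_width y))"
    using j xy' by simp
  \<comment> \<open>Since \<open>x + half_width y < 2\<close>, the rotated point also avoids the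
    singular line.\<close>
  moreover have "dubiner 2 (j + 1) (x', y') = mode j x' (half_width y') / 3 powr (1/4)"
    using xy xy' j by (intro dubiner_eq_mode) auto
  ultimately show "(dubiner 2 (j + 1) \<circ> rotation) (x, y) =
      (\<Sum>i<6. rotation_matrix $$ (i, j) * mode i x (half_width y)) / 3 powr (1/4)"
    by (simp add: rot)
qed (rule rotation_matrix_carrier)

lemma modal_reflection_2: "modal_reflection 2 = reflection_matrix"
  unfolding modal_reflection_def
proof (rule modal_matrix_2_eqI)
  fix j :: nat and x y :: real
  assume j: "j < 6" and xy: "\<bar>x\<bar> < half_width y"
  have "\<forall>j<6. mode j (- x) r = (\<Sum>i<6. reflection_matrix $$ (i, j) * mode i x r)" for r
    unfolding all_less_6 sum_less_6 mode_simps reflection_matrix_def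
    by (simp add: mat_of_rows_list_def)
  moreover have "dubiner 2 (j + 1) (- x, y) = mode j (- x) (half_width y) / 3 powr (1/4)"
    using xy j by (intro dubiner_eq_mode) auto
  ultimately show "(dubiner 2 (j + 1) \<circ> reflection) (x, y) =
      (\<Sum>i<6. reflection_matrix $$ (i, j) * mode i x (half_width y)) / 3 powr (1/4)"
    using j by (simp add: reflection_def)
qed (rule reflection_matrix_carrier)

section \<open>The extended range\<close>

lemma eq_mat_6I:
  assumes "A \<in> carrier_mat 6 6" "B \<in> carrier_mat 6 6" "\<forall>i<6. \<forall>j<6. A $$ (i, j) = B $$ (i, j)"
  shows "A = B"
  using assms by (intro eq_matI) auto

lemma index_mult_mat_6:
  assumes "A \<in> carrier_mat 6 6" "B \<in> carrier_mat 6 6" "i < 6" "j < 6"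
  shows "(A * B) $$ (i, j) = (\<Sum>k<6. A $$ (i, k) * B $$ (k, j))"
  using assms by (auto simp: scalar_prod_def atLeast0LessThan intro!: sum.cong)

lemma index_transpose_mat_6:
  assumes "A \<in> carrier_mat 6 6" "i < 6" "j < 6"
  shows "transpose_mat A $$ (i, j) = A $$ (j, i)"
  using assms by auto

lemmas modal_matrices_2 = modal_Dx_2 modal_Dy_2 modal_rotation_2 modal_reflection_2

lemma commute_6_iff:
  assumes "Q \<in> carrier_mat 6 6" "A \<in> carrier_mat 6 6"
  shows "Q * A = A * Q \<longleftrightarrow>
    (\<forall>i<6. \<forall>j<6. (\<Sum>k<6. Q $$ (i, k) * A $$ (k, j)) = (\<Sum>k<6. A $$ (i, k) * Q $$ (k, j)))"
    (is "_ \<longleftrightarrow> ?R")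
proof
  assume "Q * A = A * Q"
  then show ?R using assms by (simp flip: index_mult_mat_6)
next
  assume ?R
  then show "Q * A = A * Q"
    using assms by (intro eq_mat_6I) (auto simp: index_mult_mat_6 simp del: index_mult_mat)
qed

text \<open>The second summand is the transpose of the first, so the condition says that
  \<open>Q * D\<close> is skew-symmetric.\<close>

lemma mult_plus_transpose_6_iff:
  fixes Q D :: "real mat"
  assumes Q: "Q \<in> carrier_mat 6 6" and D: "D \<in> carrier_mat 6 6"
  shows "Q * D + transpose_mat D * transpose_mat Q = 0\<^sub>m 6 6 \<longleftrightarrow>
    (\<forall>i<6. \<forall>j<6. (\<Sum>k<6. Q $$ (i, k) * D $$ (k, j)) + (\<Sum>k<6. Q $$ (j, k) * D $$ (k, i)) = 0)"
    (is "?M = _ \<longleftrightarrow> ?R")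
proof -
  have M: "?M \<in> carrier_mat 6 6" using Q D by auto
  have "?M $$ (i, j) = (\<Sum>k<6. Q $$ (i, k) * D $$ (k, j)) + (\<Sum>k<6. Q $$ (j, k) * D $$ (k, i))"
    if ij: "i < 6" "j < 6" for i j
  proof -
    have "?M $$ (i, j) = (Q * D) $$ (i, j) + (transpose_mat D * transpose_mat Q) $$ (i, j)"
      using ij Q D by (intro index_add_mat) auto
    also have "(transpose_mat D * transpose_mat Q) $$ (i, j)
        = (\<Sum>k<6. transpose_mat D $$ (i, k) * transpose_mat Q $$ (k, j))"
      using ij Q D by (intro index_mult_mat_6) auto
    also have "\<dots> = (\<Sum>k<6. Q $$ (j, k) * D $$ (k, i))"
      using ij Q D by (intro sum.cong refl) (simp add: mult.commute)
    finally show ?thesis using index_mult_mat_6[OF Q D ij] by simp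
  qed
  moreover have "?M = 0\<^sub>m 6 6 \<longleftrightarrow> (\<forall>i<6. \<forall>j<6. ?M $$ (i, j) = 0)"
    using M by (metis eq_mat_6I index_zero_mat(1) zero_carrier_mat)
  ultimately show ?thesis by simp
qed

lemma sqrt_5_4: "sqrt (5 / 4) = sqrt 5 / 2"
  by (simp add: real_sqrt_divide)

lemma extended_range_conditions_2_iff:
  "extended_range_conditions 2 Q \<longleftrightarrow> Q \<in> carrier_mat 6 6
    \<and> (\<forall>i<6. \<forall>j<6. Q $$ (i, j) = Q $$ (j, i))
    \<and> (\<forall>i<6. \<forall>j<6. (\<Sum>k<6. Q $$ (i, k) * Dx_matrix $$ (k, j)) + (\<Sum>k<6. Q $$ (j, k) * Dx_matrix $$ (k, i)) = 0)
    \<and> (\<forall>i<6. \<forall>j<6. (\<Sum>k<6. Q $$ (i, k) * Dy_matrix $$ (k, j)) + (\<Sum>k<6. Q $$ (j, k) * Dy_matrix $$ (k, i)) = 0)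
    \<and> (\<forall>i<6. \<forall>j<6. (\<Sum>k<6. Q $$ (i, k) * rotation_matrix $$ (k, j)) = (\<Sum>k<6. rotation_matrix $$ (i, k) * Q $$ (k, j)))
    \<and> (\<forall>i<6. \<forall>j<6. (\<Sum>k<6. Q $$ (i, k) * reflection_matrix $$ (k, j)) = (\<Sum>k<6. reflection_matrix $$ (i, k) * Q $$ (k, j)))"
  (is "_ \<longleftrightarrow> _ \<and> ?S \<and> _")
proof (cases "Q \<in> carrier_mat 6 6")
  case Q: True
  have "Q = transpose_mat Q \<longleftrightarrow> ?S"
  proof
    assume "Q = transpose_mat Q"
    then show ?S using index_transpose_mat_6[OF Q] by metis
  next
    assume ?S
    then show "Q = transpose_mat Q" using Q by (intro eq_mat_6I) auto
  qed
  then show ?thesis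
    unfolding extended_range_conditions_def modal_matrices_2 num_modes_2
      mult_plus_transpose_6_iff[OF Q Dx_matrix_carrier] mult_plus_transpose_6_iff[OF Q Dy_matrix_carrier]
      commute_6_iff[OF Q rotation_matrix_carrier] commute_6_iff[OF Q reflection_matrix_carrier]
    by (rule arg_cong)
next
  case False
  then show ?thesis unfolding extended_range_conditions_def num_modes_2 by blast
qed

lemma entries_6:
  "A = mat_of_rows_list 6 [r0, r1, r2, r3, r4, r5] \<Longrightarrow>
    \<forall>i<6. \<forall>j<6. A $$ (i, j) = [r0, r1, r2, r3, r4, r5] ! i ! j"
  by (simp add: mat_of_rows_list_def)

lemma nth_6:
  "[a, b, c, d, e, f] ! 0 = a" "[a, b, c, d, e, f] ! 1 = b" "[a, b, c, d, e, f] ! 2 = c"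
  "[a, b, c, d, e, f] ! 3 = d" "[a, b, c, d, e, f] ! 4 = e" "[a, b, c, d, e, f] ! 5 = f"
  by simp_all

text \<open>Entry tables as rewrite rules; the index 1 appears as \<open>Suc 0\<close>, the form
  into which the simplifier turns it.\<close>

lemmas Dx_entries = entries_6[OF Dx_matrix_def, unfolded all_less_6 nth_6 One_nat_def]
lemmas Dy_entries = entries_6[OF Dy_matrix_def, unfolded all_less_6 nth_6 One_nat_def]
lemmas rotation_entries = entries_6[OF rotation_matrix_def, unfolded all_less_6 nth_6 One_nat_def]
lemmas reflection_entries = entries_6[OF reflection_matrix_def, unfolded all_less_6 nth_6 One_nat_def]
lemmas Q_extended_entries = entries_6[OF Q_extended_def, unfolded all_less_6 nth_6 One_nat_def sqrt_5_4]

section \<open>The two-parameter family of solutions\<close>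

lemma extended_range_conditions_Q_extended: "extended_range_conditions 2 (Q_extended q\<^sub>0 q\<^sub>1)"
proof -
  let ?Q = "Q_extended q\<^sub>0 q\<^sub>1"
  have sym: "\<forall>i<6. \<forall>j<6. ?Q $$ (i, j) = ?Q $$ (j, i)"
    unfolding all_less_6 by (intro conjI; simp add: Q_extended_entries)
  have Dx: "\<forall>i<6. \<forall>j<6. (\<Sum>k<6. ?Q $$ (i, k) * Dx_matrix $$ (k, j)) + (\<Sum>k<6. ?Q $$ (j, k) * Dx_matrix $$ (k, i)) = 0"
    unfolding all_less_6 sum_less_6 by (intro conjI; simp add: Q_extended_entries Dx_entries)
  have Dy: "\<forall>i<6. \<forall>j<6. (\<Sum>k<6. ?Q $$ (i, k) * Dy_matrix $$ (k, j)) + (\<Sum>k<6. ?Q $$ (j, k) * Dy_matrix $$ (k, i)) = 0"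
    unfolding all_less_6 sum_less_6
    by (intro conjI; simp add: Q_extended_entries Dy_entries; simp add: field_simps sqrt_mult_self_left)
  have rot: "\<forall>i<6. \<forall>j<6. (\<Sum>k<6. ?Q $$ (i, k) * rotation_matrix $$ (k, j)) = (\<Sum>k<6. rotation_matrix $$ (i, k) * ?Q $$ (k, j))"
    unfolding all_less_6 sum_less_6
    by (intro conjI; simp add: Q_extended_entries rotation_entries; simp add: field_simps sqrt_mult_self_left)
  have refl: "\<forall>i<6. \<forall>j<6. (\<Sum>k<6. ?Q $$ (i, k) * reflection_matrix $$ (k, j)) = (\<Sum>k<6. reflection_matrix $$ (i, k) * ?Q $$ (k, j))"
    unfolding all_less_6 sum_less_6
    by (intro conjI; simp add: Q_extended_entries reflection_entries)
  show ?thesis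
    unfolding extended_range_conditions_2_iff
    by (intro conjI Q_extended_carrier sym Dx Dy rot refl)
qed

lemma extended_range_conditions_imp_Q_extended:
  assumes "extended_range_conditions 2 Q"
  shows "Q = Q_extended (Q $$ (5, 5)) (Q $$ (4, 4))"
proof -
  have Q: "Q \<in> carrier_mat 6 6" and sym: "\<forall>i<6. \<forall>j<6. Q $$ (i, j) = Q $$ (j, i)"
    and x: "\<And>i j. i < 6 \<Longrightarrow> j < 6 \<Longrightarrow>
      (\<Sum>k<6. Q $$ (i, k) * Dx_matrix $$ (k, j)) + (\<Sum>k<6. Q $$ (j, k) * Dx_matrix $$ (k, i)) = 0"
    and y: "\<And>i j. i < 6 \<Longrightarrow> j < 6 \<Longrightarrow>
      (\<Sum>k<6. Q $$ (i, k) * Dy_matrix $$ (k, j)) + (\<Sum>k<6. Q $$ (j, k) * Dy_matrix $$ (k, i)) = 0"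
    and rot: "\<And>i j. i < 6 \<Longrightarrow> j < 6 \<Longrightarrow>
      (\<Sum>k<6. Q $$ (i, k) * rotation_matrix $$ (k, j)) = (\<Sum>k<6. rotation_matrix $$ (i, k) * Q $$ (k, j))"
    and refl: "\<And>i j. i < 6 \<Longrightarrow> j < 6 \<Longrightarrow>
      (\<Sum>k<6. Q $$ (i, k) * reflection_matrix $$ (k, j)) = (\<Sum>k<6. reflection_matrix $$ (i, k) * Q $$ (k, j))"
    using assms unfolding extended_range_conditions_2_iff by blast+
  have s: "Q $$ (1, 0) = Q $$ (0, 1)" "Q $$ (2, 0) = Q $$ (0, 2)" "Q $$ (3, 0) = Q $$ (0, 3)"
    "Q $$ (4, 0) = Q $$ (0, 4)" "Q $$ (5, 0) = Q $$ (0, 5)" "Q $$ (2, 1) = Q $$ (1, 2)"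
    "Q $$ (3, 1) = Q $$ (1, 3)" "Q $$ (4, 1) = Q $$ (1, 4)" "Q $$ (5, 1) = Q $$ (1, 5)"
    "Q $$ (3, 2) = Q $$ (2, 3)" "Q $$ (4, 2) = Q $$ (2, 4)" "Q $$ (5, 2) = Q $$ (2, 5)"
    "Q $$ (4, 3) = Q $$ (3, 4)" "Q $$ (5, 3) = Q $$ (3, 5)" "Q $$ (5, 4) = Q $$ (4, 5)"
    using sym by auto
  note [simp] = s[unfolded One_nat_def] sum_less_6 Dx_entries Dy_entries rotation_entries reflection_entries
  \<comment> \<open>The order matters: each step isolates one new entry, the others in its equation
    being zero by the rules declared before.\<close>
  have z1 [simp]: "Q $$ (0, 0) = 0" using x[of 0 3] by simp
  have z2 [simp]: "Q $$ (0, Suc 0) = 0" using x[of 0 4] by simp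
  have z3 [simp]: "Q $$ (0, 3) = 0" using x[of 0 5] by simp
  have z4 [simp]: "Q $$ (Suc 0, Suc 0) = 0" using x[of 1 4] by simp
  have z5 [simp]: "Q $$ (Suc 0, 3) = 0" using x[of 1 5] by simp
  have z6 [simp]: "Q $$ (0, 2) = 0" using x[of 2 3] by simp
  have z7 [simp]: "Q $$ (Suc 0, 2) = 0" using x[of 2 4] by simp
  have z8 [simp]: "Q $$ (2, 3) = 0" using x[of 2 5] by simp
  have z9 [simp]: "Q $$ (0, 4) = 0" using x[of 4 3] by simp
  have z10 [simp]: "Q $$ (Suc 0, 4) = 0" using x[of 4 4] by simp
  have z11 [simp]: "Q $$ (3, 5) = 0" using x[of 5 5] y[of 3 5] by simp
  have z12 [simp]: "Q $$ (3, 3) = 0" using y[of 3 4] by simp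
  have z13 [simp]: "Q $$ (0, 5) = 0" using x[of 3 5] by simp
  have z14 [simp]: "Q $$ (Suc 0, 5) = 0" using y[of 5 5] by simp
  have z15 [simp]: "Q $$ (3, 4) = 0" using x[of 4 5] by simp
  \<comment> \<open>The even modes 2 and 5 cannot couple with the odd mode 4, because the reflection
    gives the two sides opposite signs.\<close>
  have z16 [simp]: "Q $$ (2, 4) = 0" using refl[of 2 4] by simp
  have z17 [simp]: "Q $$ (4, 5) = 0" using refl[of 4 5] by simp
  \<comment> \<open>The rotation mixes the odd mode 4 with the modes 2 and 5; the commutation
    relation at \<open>(2, 4)\<close> and \<open>(5, 4)\<close> expresses \<open>Q $$ (2, 2)\<close>
    and \<open>Q $$ (2, 5)\<close> by the free entries \<open>Q $$ (4, 4)\<close> and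
    \<open>Q $$ (5, 5)\<close>.\<close>
  have "sqrt 3 * (Q $$ (2, 2) - sqrt 5 / 2 * Q $$ (2, 5) - Q $$ (4, 4)) = 0"
    using rot[of 2 4] by (simp add: algebra_simps)
  then have a: "Q $$ (2, 2) = Q $$ (4, 4) + sqrt 5 / 2 * Q $$ (2, 5)" by simp
  have "sqrt 3 * (2 * Q $$ (2, 5) - sqrt 5 * (Q $$ (5, 5) - Q $$ (4, 4))) = 0"
    using rot[of 5 4] by (simp add: algebra_simps)
  then have b: "Q $$ (2, 5) = (Q $$ (5, 5) - Q $$ (4, 4)) * sqrt 5 / 2"
    by (simp add: mult.commute)
  show ?thesis
    by (rule eq_mat_6I[OF Q Q_extended_carrier], unfold all_less_6, intro conjI)
      (simp_all add: Q_extended_entries a b sqrt_mult_self_left field_simps)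
qed

section \<open>Positive definiteness\<close>

text \<open>Diagonal form in the eigenbasis: both \<open>(2, - sqrt 5)\<close> and
  \<open>(sqrt 5, 2)\<close> have squared length 9, and the last coefficient is the eigenvalue
  \<open>1 + (9 * q\<^sub>0 - 5 * q\<^sub>1) / 4\<close> of the second one.\<close>

lemma quadratic_form_Q_extended:
  assumes z: "z \<in> carrier_vec 6"
  shows "scalar_prod z ((1\<^sub>m 6 + Q_extended q\<^sub>0 q\<^sub>1) *\<^sub>v z) =
    (z $ 0)\<^sup>2 + (z $ 1)\<^sup>2 + (z $ 3)\<^sup>2 + (1 + q\<^sub>1) * (z $ 4)\<^sup>2
    + (1 + q\<^sub>1) * ((2 * z $ 2 - sqrt 5 * z $ 5)\<^sup>2 / 9)
    + (4 + 9 * q\<^sub>0 - 5 * q\<^sub>1) / 4 * ((sqrt 5 * z $ 2 + 2 * z $ 5)\<^sup>2 / 9)"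
proof -
  let ?Q = "Q_extended q\<^sub>0 q\<^sub>1"
  have carr: "1\<^sub>m 6 + ?Q \<in> carrier_mat 6 6" using Q_extended_carrier by auto
  have ent: "(1\<^sub>m 6 + ?Q) $$ (i, j) = (if i = j then 1 else 0) + ?Q $$ (i, j)" if "i < 6" "j < 6" for i j
    using that Q_extended_carrier[of q\<^sub>0 q\<^sub>1] by auto
  have "scalar_prod z ((1\<^sub>m 6 + ?Q) *\<^sub>v z) = (\<Sum>i<6. z $ i * (\<Sum>j<6. (1\<^sub>m 6 + ?Q) $$ (i, j) * z $ j))"
    using z carr Q_extended_carrier[of q\<^sub>0 q\<^sub>1]
    by (auto simp: scalar_prod_def atLeast0LessThan intro!: sum.cong)
  also have "\<dots> = (\<Sum>i<6. z $ i * (\<Sum>j<6. ((if i = j then 1 else 0) + ?Q $$ (i, j)) * z $ j))"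
    by (intro sum.cong refl arg_cong2[where f = "(*)"]) (auto simp: ent)
  finally show ?thesis
    by (simp add: sum_less_6 Q_extended_entries power2_eq_square sqrt_mult_self_left field_simps)
qed

lemma positive_definite_Q_extended:
  "positive_definite (1\<^sub>m 6 + Q_extended q\<^sub>0 q\<^sub>1) \<longleftrightarrow> q\<^sub>1 > -1 \<and> 9 * q\<^sub>0 - 5 * q\<^sub>1 > -4"
proof -
  let ?B = "1\<^sub>m 6 + Q_extended q\<^sub>0 q\<^sub>1"
  have carr: "?B \<in> carrier_mat 6 6" using Q_extended_carrier by auto
  have sym: "transpose_mat ?B = ?B"
  proof (rule eq_mat_6I)
    show "\<forall>i<6. \<forall>j<6. transpose_mat ?B $$ (i, j) = ?B $$ (i, j)"
      using Q_extended_carrier[of q\<^sub>0 q\<^sub>1] unfolding all_less_6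
      by (intro conjI) (simp_all add: Q_extended_entries)
  qed (use carr in auto)
  have "positive_definite ?B \<longleftrightarrow> (\<forall>z \<in> carrier_vec 6. z \<noteq> 0\<^sub>v 6 \<longrightarrow> scalar_prod z (?B *\<^sub>v z) > 0)"
    using carr sym Q_extended_carrier[of q\<^sub>0 q\<^sub>1]
    by (auto simp: positive_definite_def)
  also have "\<dots> \<longleftrightarrow> q\<^sub>1 > -1 \<and> 9 * q\<^sub>0 - 5 * q\<^sub>1 > -4" (is "?L \<longleftrightarrow> ?R")
  proof
    assume L: ?L
    \<comment> \<open>Eigenvectors as test vectors: \<open>u\<close> is mode 4, and \<open>v\<close>
      is \<open>(sqrt 5, 2)\<close> in the modes 2 and 5, where the square with the coefficient
      \<open>1 + q\<^sub>1\<close> vanishes.\<close>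
    define u v :: "real vec" where uv: "u = vec 6 (\<lambda>i. [0, 0, 0, 0, 1, 0] ! i)" "v = vec 6 (\<lambda>i. [0, 0, sqrt 5, 0, 0, 2] ! i)"
    have carr: "u \<in> carrier_vec 6" "v \<in> carrier_vec 6" unfolding uv by auto
    moreover have "u $ 4 \<noteq> 0\<^sub>v 6 $ 4" "v $ 5 \<noteq> 0\<^sub>v 6 $ 5" by (auto simp: uv)
    ultimately have "scalar_prod u (?B *\<^sub>v u) > 0" "scalar_prod v (?B *\<^sub>v v) > 0"
      using L by metis+
    then show ?R
      unfolding quadratic_form_Q_extended[OF carr(1)] quadratic_form_Q_extended[OF carr(2)]
      by (simp_all add: uv)
  next
    assume R: ?R
    \<comment> \<open>The smallest eigenvalue; the form is at least \<open>l\<close> times the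
      squared length of \<open>z\<close>.\<close>
    define l where "l = Min {1, 1 + q\<^sub>1, (4 + 9 * q\<^sub>0 - 5 * q\<^sub>1) / 4}"
    have l: "l \<le> 1" "l \<le> 1 + q\<^sub>1" "l \<le> (4 + 9 * q\<^sub>0 - 5 * q\<^sub>1) / 4"
      unfolding l_def by (rule Min_le; simp)+
    have l_pos: "l > 0"
      using R by (simp add: l_def)
    show ?L
    proof (intro ballI impI)
      fix z :: "real vec" assume z: "z \<in> carrier_vec 6" "z \<noteq> 0\<^sub>v 6"
      then obtain i where i: "i < 6" "z $ i \<noteq> 0" by (metis carrier_vecD eq_vecI index_zero_vec)
      have "0 < (\<Sum>i<6. (z $ i)\<^sup>2)"
        by (rule sum_pos2[of _ i]) (use i in auto)
      then have "0 < l * (\<Sum>i<6. (z $ i)\<^sup>2)" using l_pos by simp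
      \<comment> \<open>The normalised components along the two orthogonal eigenvectors replace
        \<open>z $ 2\<close> and \<open>z $ 5\<close> without changing the squared length.\<close>
      also have "\<dots> = l * (z $ 0)\<^sup>2 + l * (z $ 1)\<^sup>2 + l * (z $ 3)\<^sup>2 + l * (z $ 4)\<^sup>2
          + l * ((2 * z $ 2 - sqrt 5 * z $ 5)\<^sup>2 / 9) + l * ((sqrt 5 * z $ 2 + 2 * z $ 5)\<^sup>2 / 9)"
        by (simp add: sum_less_6 power2_eq_square sqrt_mult_self_left field_simps)
      also have "\<dots> \<le> 1 * (z $ 0)\<^sup>2 + 1 * (z $ 1)\<^sup>2 + 1 * (z $ 3)\<^sup>2 + (1 + q\<^sub>1) * (z $ 4)\<^sup>2
          + (1 + q\<^sub>1) * ((2 * z $ 2 - sqrt 5 * z $ 5)\<^sup>2 / 9)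
          + (4 + 9 * q\<^sub>0 - 5 * q\<^sub>1) / 4 * ((sqrt 5 * z $ 2 + 2 * z $ 5)\<^sup>2 / 9)"
        by (intro add_mono mult_right_mono l) auto
      also have "\<dots> = scalar_prod z (?B *\<^sub>v z)"
        unfolding quadratic_form_Q_extended[OF z(1)] by simp
      finally show "scalar_prod z (?B *\<^sub>v z) > 0" .
    qed
  qed
  finally show ?thesis .
qed

section \<open>The single-parameter scheme\<close>

lemma modal_K_carrier: "modal_K m 2 \<in> carrier_mat 6 6"
  unfolding modal_K_def modal_matrices_2
  by (rule mult_carrier_mat; rule pow_carrier_mat, rule Dx_matrix_carrier Dy_matrix_carrier)

text \<open>Second derivatives of quadratic polynomials are constant, so only the first row survives.\<close>

lemma modal_K_2:
  assumes "i < 6" "j < 6"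
  shows "modal_K 1 2 $$ (i, j) = (if i = 0 then [0, 0, 0, 0, 0, 3 * sqrt 3 * sqrt 5] ! j else 0)"
    "modal_K 2 2 $$ (i, j) = (if i = 0 then [0, 0, 0, 0, 5 * sqrt 3, 0] ! j else 0)"
    "modal_K 3 2 $$ (i, j) = (if i = 0 then [0, 0, 20 * sqrt 3 / 3, 0, 0, - sqrt 3 * sqrt 5 / 3] ! j else 0)"
proof -
  note Dx = Dx_matrix_carrier and Dy = Dy_matrix_carrier
  have K: "modal_K 1 2 = Dx_matrix * Dx_matrix" "modal_K 2 2 = Dx_matrix * Dy_matrix"
    "modal_K 3 2 = Dy_matrix * Dy_matrix"
    unfolding modal_K_def modal_matrices_2
    using Dx Dy by (simp_all add: numeral_2_eq_2)
  have "\<forall>i<6. \<forall>j<6. modal_K 1 2 $$ (i, j) = (if i = 0 then [0, 0, 0, 0, 0, 3 * sqrt 3 * sqrt 5] ! j else 0)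
    \<and> modal_K 2 2 $$ (i, j) = (if i = 0 then [0, 0, 0, 0, 5 * sqrt 3, 0] ! j else 0)
    \<and> modal_K 3 2 $$ (i, j) = (if i = 0 then [0, 0, 20 * sqrt 3 / 3, 0, 0, - sqrt 3 * sqrt 5 / 3] ! j else 0)"
    unfolding K all_less_6
    by (intro conjI) (simp_all add: index_mult_mat_6[OF Dx Dx] index_mult_mat_6[OF Dx Dy] index_mult_mat_6[OF Dy Dy]
        sum_less_6 Dx_entries Dy_entries sqrt_mult_self_left del: index_mult_mat)
  then show "modal_K 1 2 $$ (i, j) = (if i = 0 then [0, 0, 0, 0, 0, 3 * sqrt 3 * sqrt 5] ! j else 0)"
    "modal_K 2 2 $$ (i, j) = (if i = 0 then [0, 0, 0, 0, 5 * sqrt 3, 0] ! j else 0)"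
    "modal_K 3 2 $$ (i, j) = (if i = 0 then [0, 0, 20 * sqrt 3 / 3, 0, 0, - sqrt 3 * sqrt 5 / 3] ! j else 0)"
    using assms by blast+
qed

text \<open>The factor \<open>ref_area\<close> cancels the division in \<open>Q_castonguay\<close>.
  Only the first rows of the \<open>modal_K m 2\<close> survive: the mixed derivative, with binomial
  weight 2, gives mode 4 the value \<open>2 * 75 = 150\<close>, and the pure ones give mode 5 the
  value \<open>135 + 5 / 3 = 410 / 3\<close>.\<close>

lemma Q_castonguay_2: "Q_castonguay 2 (ref_area * c) = Q_extended (410 * c / 3) (150 * c)"
proof (rule eq_mat_6I[OF _ Q_extended_carrier])
  have KK: "(transpose_mat (modal_K m 2) * modal_mass 2 * modal_K m 2) $$ (i, j)
      = (\<Sum>k<6. modal_K m 2 $$ (k, i) * modal_K m 2 $$ (k, j))" if "i < 6" "j < 6" for m i j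
  proof -
    note K = modal_K_carrier[of m]
    have "transpose_mat (modal_K m 2) * modal_mass 2 = transpose_mat (modal_K m 2)"
      using K by (auto simp: modal_mass_2)
    then show ?thesis
      using that K by (auto simp: scalar_prod_def atLeast0LessThan intro!: sum.cong)
  qed
  have "Q_castonguay 2 (ref_area * c) $$ (i, j) = c * (\<Sum>m = 1..3. real (2 choose (m - 1))
      * (\<Sum>k<6. modal_K m 2 $$ (k, i) * modal_K m 2 $$ (k, j)))" if "i < 6" "j < 6" for i j
    using that by (simp add: Q_castonguay_def num_modes_2 KK ref_area)
  then have *: "Q_castonguay 2 (ref_area * c) $$ (i, j) = c * (\<Sum>k<6.
      modal_K 1 2 $$ (k, i) * modal_K 1 2 $$ (k, j) + 2 * (modal_K 2 2 $$ (k, i) * modal_K 2 2 $$ (k, j))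
      + modal_K 3 2 $$ (k, i) * modal_K 3 2 $$ (k, j))" if "i < 6" "j < 6" for i j
    using that by (simp add: numeral_3_eq_3 numeral_2_eq_2 sum.distrib sum_distrib_left algebra_simps)
  show "\<forall>i<6. \<forall>j<6. Q_castonguay 2 (ref_area * c) $$ (i, j)
      = Q_extended (410 * c / 3) (150 * c) $$ (i, j)"
    unfolding all_less_6
    by (intro conjI) (simp_all add: * sum_less_6 modal_K_2[unfolded One_nat_def] Q_extended_entries sqrt_mult_self_left field_simps)
qed (simp add: Q_castonguay_def num_modes_2)

theorem mainTheorem6:
  shows "(\<forall>Q. extended_range_conditions 2 Q \<longleftrightarrow> (\<exists>q\<^sub>0 q\<^sub>1. Q = Q_extended q\<^sub>0 q\<^sub>1))
    \<and> (\<forall>q\<^sub>0 q\<^sub>1. positive_definite (modal_mass 2 + Q_extended q\<^sub>0 q\<^sub>1)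
          \<longleftrightarrow> q\<^sub>1 > -1 \<and> 9 * q\<^sub>0 - 5 * q\<^sub>1 > -4)
    \<and> (\<forall>c. Q_castonguay 2 (ref_area * c) = Q_extended (410 * c / 3) (150 * c))
    \<and> (\<forall>c. positive_definite (modal_mass 2 + Q_castonguay 2 (ref_area * c)) \<longleftrightarrow> c > -1 / 150)"
proof (intro conjI allI)
  show "extended_range_conditions 2 Q \<longleftrightarrow> (\<exists>q\<^sub>0 q\<^sub>1. Q = Q_extended q\<^sub>0 q\<^sub>1)" for Q
    using extended_range_conditions_imp_Q_extended extended_range_conditions_Q_extended by blast
  show "positive_definite (modal_mass 2 + Q_extended q\<^sub>0 q\<^sub>1) \<longleftrightarrow> q\<^sub>1 > -1 \<and> 9 * q\<^sub>0 - 5 * q\<^sub>1 > -4" for q\<^sub>0 q\<^sub>1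
    unfolding modal_mass_2 by (rule positive_definite_Q_extended)
  show "Q_castonguay 2 (ref_area * c) = Q_extended (410 * c / 3) (150 * c)" for c
    by (rule Q_castonguay_2)
  \<comment> \<open>The two conditions become \<open>150 * c > -1\<close> and
    \<open>480 * c > -4\<close>; the second is \<open>c > - 1 / 120\<close> and follows from the
    first.\<close>
  show "positive_definite (modal_mass 2 + Q_castonguay 2 (ref_area * c)) \<longleftrightarrow> c > -1 / 150" for c
    unfolding modal_mass_2 Q_castonguay_2 positive_definite_Q_extended by auto
qed

end
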